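(* Let $\tau$ be a finite unary (monadic) vocabulary, let $c_\tau := 15|\tau|2^{|\tau|}$, and let $\mathfrak{M}$ be a $\tau$-model of size $n$. Let $T = \{\pi_1, \dots, \pi_\ell\}$ be the $\tau$-types realized in $\mathfrak{M}$, enumerated so that $|\pi_1| \leq |\pi_2| \leq \dots \leq |\pi_\ell|$, where $|\pi|$ denotes the number of points of $\mathfrak{M}$ realizing $\pi$. Then \[ C(\mathfrak{M}) \leq \min\big(3|\pi_\ell| + c_\tau,\ 6|\pi_{\ell-1}| + c_\tau\big). \]
   Context: A $\tau$-model of size $n$ is a structure $\mathfrak{M} = (M, P_1^{\mathfrak{M}}, \dots, P_k^{\mathfrak{M}})$ with domain $M = \{1,\dots,n\}$ and $P_i^{\mathfrak{M}} \subseteq M$, where $\tau = \{P_1,\dots,P_k\}$ consists of unary relation symbols. A $\tau$-type is a subset $\pi \subseteq \tau$; a point $a$ realizes $\pi$ if for all $P\in\tau$, $a \in P^{\mathfrak{M}}$ iff $P \in \pi$. First-order formulas $\mathrm{FO}[\tau]$ are built from atomic formulas $x=y$, $P(x)$ using $\neg,\lor,\land,\exists,\forall$, and are taken in negation normal form (negations only on atoms). The size of a formula is the number of atomic formulas (including negated atoms), conjunctions, disjunctions and quantifiers in it; negations do not count. A sentence $\varphi$ defines $\mathfrak{M}$ if for every $\tau$-model $\mathfrak{M}'$ of size $n$, $\mathfrak{M}' \models \varphi$ iff $\mathfrak{M}'$ is isomorphic to $\mathfrak{M}$. The description complexity $C(\mathfrak{M})$ is the minimum size of an $\mathrm{FO}[\tau]$-formula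 defining $\mathfrak{M}$. *)

theory Defs
  imports Main "HOL-Library.Extended_Nat"
begin

text \<open>A unary vocabulary is a set \<open>\<tau>\<close> of predicate symbols of type \<open>'p\<close>; variables are
  natural numbers. Values of \<open>interp\<close> at symbols outside \<open>\<tau>\<close> carry no meaning.\<close>

record 'p model =
  universe :: "nat set"
  interp :: "'p \<Rightarrow> nat set"

definition is_model :: "'p set \<Rightarrow> nat \<Rightarrow> 'p model \<Rightarrow> bool" where
  "is_model \<tau> n M \<longleftrightarrow> universe M = {1..n} \<and> (\<forall>P\<in>\<tau>. interp M P \<subseteq> universe M)"

definition isomorphic :: "'p set \<Rightarrow> 'p model \<Rightarrow> 'p model \<Rightarrow> bool" where
  "isomorphic \<tau> M N \<longleftrightarrow>
     (\<exists>f. bij_betw f (universe M) (universe N) \<and>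
          (\<forall>P\<in>\<tau>. \<forall>a\<in>universe M. a \<in> interp M P \<longleftrightarrow> f a \<in> interp N P))"

definition realizes :: "'p set \<Rightarrow> 'p model \<Rightarrow> nat \<Rightarrow> 'p set \<Rightarrow> bool" where
  "realizes \<tau> M a \<pi> \<longleftrightarrow> (\<forall>P\<in>\<tau>. a \<in> interp M P \<longleftrightarrow> P \<in> \<pi>)"

definition realized_types :: "'p set \<Rightarrow> 'p model \<Rightarrow> 'p set set" where
  "realized_types \<tau> M = {\<pi>. \<pi> \<subseteq> \<tau> \<and> (\<exists>a\<in>universe M. realizes \<tau> M a \<pi>)}"

definition type_count :: "'p set \<Rightarrow> 'p model \<Rightarrow> 'p set \<Rightarrow> nat" where
  "type_count \<tau> M \<pi> = card {a \<in> universe M. realizes \<tau> M a \<pi>}"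

datatype 'p fm =
    Eq nat nat
  | Pred 'p nat
  | Neg "'p fm"
  | Conj "'p fm" "'p fm"
  | Disj "'p fm" "'p fm"
  | Exists nat "'p fm"
  | Forall nat "'p fm"

primrec sat :: "'p model \<Rightarrow> (nat \<Rightarrow> nat) \<Rightarrow> 'p fm \<Rightarrow> bool" where
  "sat M s (Eq x y) \<longleftrightarrow> s x = s y"
| "sat M s (Pred P x) \<longleftrightarrow> s x \<in> interp M P"
| "sat M s (Neg \<phi>) \<longleftrightarrow> \<not> sat M s \<phi>"
| "sat M s (Conj \<phi> \<psi>) \<longleftrightarrow> sat M s \<phi> \<and> sat M s \<psi>"
| "sat M s (Disj \<phi> \<psi>) \<longleftrightarrow> sat M s \<phi> \<or> sat M s \<psi>"
| "sat M s (Exists x \<phi>) \<longleftrightarrow> (\<exists>a\<in>universe M. sat M (s(x := a)) \<phi>)"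
| "sat M s (Forall x \<phi>) \<longleftrightarrow> (\<forall>a\<in>universe M. sat M (s(x := a)) \<phi>)"

primrec free_vars :: "'p fm \<Rightarrow> nat set" where
  "free_vars (Eq x y) = {x, y}"
| "free_vars (Pred P x) = {x}"
| "free_vars (Neg \<phi>) = free_vars \<phi>"
| "free_vars (Conj \<phi> \<psi>) = free_vars \<phi> \<union> free_vars \<psi>"
| "free_vars (Disj \<phi> \<psi>) = free_vars \<phi> \<union> free_vars \<psi>"
| "free_vars (Exists x \<phi>) = free_vars \<phi> - {x}"
| "free_vars (Forall x \<phi>) = free_vars \<phi> - {x}"

primrec preds :: "'p fm \<Rightarrow> 'p set" where
  "preds (Eq x y) = {}"
| "preds (Pred P x) = {P}"
| "preds (Neg \<phi>) = preds \<phi>"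
| "preds (Conj \<phi> \<psi>) = preds \<phi> \<union> preds \<psi>"
| "preds (Disj \<phi> \<psi>) = preds \<phi> \<union> preds \<psi>"
| "preds (Exists x \<phi>) = preds \<phi>"
| "preds (Forall x \<phi>) = preds \<phi>"

primrec atomic :: "'p fm \<Rightarrow> bool" where
  "atomic (Eq x y) = True"
| "atomic (Pred P x) = True"
| "atomic (Neg \<phi>) = False"
| "atomic (Conj \<phi> \<psi>) = False"
| "atomic (Disj \<phi> \<psi>) = False"
| "atomic (Exists x \<phi>) = False"
| "atomic (Forall x \<phi>) = False"

primrec nnf :: "'p fm \<Rightarrow> bool" where
  "nnf (Eq x y) = True"
| "nnf (Pred P x) = True"
| "nnf (Neg \<phi>) = atomic \<phi>"
| "nnf (Conj \<phi> \<psi>) \<longleftrightarrow> nnf \<phi> \<and> nnf \<psi>"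
| "nnf (Disj \<phi> \<psi>) \<longleftrightarrow> nnf \<phi> \<and> nnf \<psi>"
| "nnf (Exists x \<phi>) = nnf \<phi>"
| "nnf (Forall x \<phi>) = nnf \<phi>"

text \<open>Negations are not counted.\<close>

primrec fm_size :: "'p fm \<Rightarrow> nat" where
  "fm_size (Eq x y) = 1"
| "fm_size (Pred P x) = 1"
| "fm_size (Neg \<phi>) = fm_size \<phi>"
| "fm_size (Conj \<phi> \<psi>) = fm_size \<phi> + fm_size \<psi> + 1"
| "fm_size (Disj \<phi> \<psi>) = fm_size \<phi> + fm_size \<psi> + 1"
| "fm_size (Exists x \<phi>) = fm_size \<phi> + 1"
| "fm_size (Forall x \<phi>) = fm_size \<phi> + 1"

definition sentence :: "'p set \<Rightarrow> 'p fm \<Rightarrow> bool" where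
  "sentence \<tau> \<phi> \<longleftrightarrow> nnf \<phi> \<and> preds \<phi> \<subseteq> \<tau> \<and> free_vars \<phi> = {}"

text \<open>Applied to sentences only, so the choice of assignment is immaterial.\<close>

definition satisfies :: "'p model \<Rightarrow> 'p fm \<Rightarrow> bool" where
  "satisfies M \<phi> \<longleftrightarrow> (\<forall>s. range s \<subseteq> universe M \<longrightarrow> sat M s \<phi>)"

definition defines_model :: "'p set \<Rightarrow> nat \<Rightarrow> 'p fm \<Rightarrow> 'p model \<Rightarrow> bool" where
  "defines_model \<tau> n \<phi> M \<longleftrightarrow>
     sentence \<tau> \<phi> \<and>
     (\<forall>M'. is_model \<tau> n M' \<longrightarrow> (satisfies M' \<phi> \<longleftrightarrow> isomorphic \<tau> M' M))"

text \<open>The infimum is taken in \<^typ>\<open>enat\<close>, where \<open>Inf {} = \<infinity>\<close>: a finite bound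
  therefore entails that a defining sentence exists, and then the infimum is a minimum.
  Over \<^typ>\<open>nat\<close> one would have \<open>Inf {} = 0\<close>.\<close>

definition description_complexity :: "'p set \<Rightarrow> nat \<Rightarrow> 'p model \<Rightarrow> enat" where
  "description_complexity \<tau> n M = (INF \<phi>\<in>{\<phi>. defines_model \<tau> n \<phi> M}. enat (fm_size \<phi>))"

definition c_const :: "'p set \<Rightarrow> nat" where
  "c_const \<tau> = 15 * card \<tau> * 2 ^ card \<tau>"

end

theory Submission
  imports Defs
begin

text \<open>Order the types by their thresholds \<open>d\<^sub>1 \<le> d\<^sub>2 \<le> \<dots> \<le> m\<close>. The formula
  \<open>\<forall>x\<^sub>1\<dots>x\<^sub>m. \<exists>y. y \<noteq> x\<^sub>1 \<and> \<dots> \<and> y \<noteq> x\<^sub>d\<^sub>1 \<and> (\<pi>\<^sub>1(y) \<and> \<pi>\<^sub>1(z) \<or> (y \<noteq> x\<^sub>d\<^sub>1\<^sub>+\<^sub>1 \<and> \<dots> \<and> y \<noteq> x\<^sub>d\<^sub>2 \<and> (\<pi>\<^sub>2(y) \<and> \<pi>\<^sub>2(z) \<or> \<dots>)))\<close>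
  says that \<open>z\<close> has one of these types \<open>\<pi>\<^sub>i\<close>, and that \<open>\<pi>\<^sub>i\<close> is realized more than \<open>d\<^sub>i\<close> times.
  The nesting lets all types share the variables \<open>x\<^sub>j\<close> and the literals \<open>y \<noteq> x\<^sub>j\<close>, so the size is
  \<open>3m\<close> plus a constant. Quantifying \<open>z\<close> universally turns it into lower bounds for all types at
  once, and these already determine the model because the total number of points is \<open>n\<close>. If the
  largest type is left out, lower bounds (at cost \<open>3m\<close>) and upper bounds (the negation of the
  formula with \<open>z\<close> quantified existentially, again at cost \<open>3m\<close>) for the remaining types determine
  the number of points of the largest type.\<close>

section \<open>Types, their counts, and isomorphism\<close>

text \<open>Each point realizes exactly one subset of \<open>\<tau>\<close>; as a function of the
  point, it turns type counts into fibre sizes.\<close>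

definition type_of :: "'p set \<Rightarrow> 'p model \<Rightarrow> nat \<Rightarrow> 'p set" where
  "type_of \<tau> M a = {P \<in> \<tau>. a \<in> interp M P}"

lemma realizes_iff: "\<pi> \<subseteq> \<tau> \<Longrightarrow> realizes \<tau> M a \<pi> \<longleftrightarrow> type_of \<tau> M a = \<pi>"
  by (auto simp: realizes_def type_of_def)

lemma realized_types_eq: "realized_types \<tau> M = type_of \<tau> M ` universe M"
proof -
  have "type_of \<tau> M a \<subseteq> \<tau>" for a by (auto simp: type_of_def)
  then show ?thesis by (auto simp: realized_types_def realizes_iff)
qed

lemma type_count_eq:
  "\<pi> \<subseteq> \<tau> \<Longrightarrow> type_count \<tau> M \<pi> = card {a \<in> universe M. type_of \<tau> M a = \<pi>}"
  by (simp add: type_count_def realizes_iff)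

lemma type_count_pos_iff:
  assumes "finite (universe M)"
  shows "0 < type_count \<tau> M \<pi> \<longleftrightarrow> (\<exists>a\<in>universe M. realizes \<tau> M a \<pi>)"
  using assms by (auto simp: type_count_def card_gt_0_iff)

lemma realized_types_iff:
  "finite (universe M) \<Longrightarrow> \<pi> \<in> realized_types \<tau> M \<longleftrightarrow> \<pi> \<subseteq> \<tau> \<and> 0 < type_count \<tau> M \<pi>"
  by (simp add: realized_types_def type_count_pos_iff)

text \<open>The fibres of \<open>type_of\<close> partition the universe; types in \<open>T\<close>
  without points contribute 0.\<close>

lemma sum_type_count:
  assumes "finite (universe M)" "finite T" "T \<subseteq> Pow \<tau>" "realized_types \<tau> M \<subseteq> T"
  shows "(\<Sum>\<pi>\<in>T. type_count \<tau> M \<pi>) = card (universe M)"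
proof -
  have "(\<Sum>\<pi>\<in>T. type_count \<tau> M \<pi>) = (\<Sum>\<pi>\<in>T. \<Sum>a\<in>{a \<in> universe M. type_of \<tau> M a = \<pi>}. 1)"
    using assms(3) by (intro sum.cong) (auto simp: type_count_eq)
  also have "\<dots> = (\<Sum>a\<in>universe M. 1)"
    using assms by (intro sum.group) (auto simp: realized_types_eq)
  finally show ?thesis by simp
qed

lemma isomorphic_type_count_eq:
  assumes "isomorphic \<tau> M N"
  shows "type_count \<tau> M \<pi> = type_count \<tau> N \<pi>"
proof -
  obtain f where f: "bij_betw f (universe M) (universe N)"
    and P: "\<forall>P\<in>\<tau>. \<forall>a\<in>universe M. a \<in> interp M P \<longleftrightarrow> f a \<in> interp N P"
    using assms by (auto simp: isomorphic_def)
  have r: "realizes \<tau> M a \<pi> \<longleftrightarrow> realizes \<tau> N (f a) \<pi>" if "a \<in> universe M" for a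
    using P that by (auto simp: realizes_def)
  have "{b \<in> universe N. realizes \<tau> N b \<pi>} = f ` {a \<in> universe M. realizes \<tau> M a \<pi>}"
    using r by (auto simp: bij_betw_imp_surj_on[OF f, symmetric])
  moreover have "inj_on f {a \<in> universe M. realizes \<tau> M a \<pi>}"
    using bij_betw_imp_inj_on[OF f] by (rule inj_on_subset) auto
  ultimately show ?thesis
    by (simp add: type_count_def card_image)
qed

text \<open>Fibres of equal size are in bijection, and bijections chosen type by type glue to an
  isomorphism.\<close>

lemma isomorphicI_type_count:
  assumes fin: "finite (universe M)" "finite (universe N)"
    and eq: "\<And>\<pi>. \<pi> \<subseteq> \<tau> \<Longrightarrow> type_count \<tau> M \<pi> = type_count \<tau> N \<pi>"
  shows "isomorphic \<tau> M N"
proof -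
  define A where "A M \<pi> = {a \<in> universe M. type_of \<tau> M a = \<pi>}" for M :: "'a model" and \<pi>
  have sub: "type_of \<tau> M a \<subseteq> \<tau>" for M a by (auto simp: type_of_def)
  have "\<exists>h. bij_betw h (A M \<pi>) (A N \<pi>)" if "\<pi> \<subseteq> \<tau>" for \<pi>
    using fin eq[OF that] that by (intro finite_same_card_bij) (auto simp: A_def type_count_eq)
  then obtain h where h: "\<And>\<pi>. \<pi> \<subseteq> \<tau> \<Longrightarrow> bij_betw (h \<pi>) (A M \<pi>) (A N \<pi>)" by metis
  define f where "f a = h (type_of \<tau> M a) a" for a
  have f: "f a \<in> A N (type_of \<tau> M a)" if "a \<in> universe M" for a
    using bij_betwE[OF h[OF sub]] that by (auto simp: f_def A_def)
  have "bij_betw f (universe M) (universe N)"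
  proof (rule bij_betw_imageI)
    show "inj_on f (universe M)"
    proof (rule inj_onI)
      fix a b assume ab: "a \<in> universe M" "b \<in> universe M" "f a = f b"
      then have t: "type_of \<tau> M a = type_of \<tau> M b"
        using f[of a] f[of b] by (auto simp: A_def)
      have "inj_on (h (type_of \<tau> M a)) (A M (type_of \<tau> M a))"
        using h[OF sub] by (rule bij_betw_imp_inj_on)
      then show "a = b"
        using ab t by (auto simp: f_def A_def dest: inj_onD)
    qed
    show "f ` universe M = universe N"
    proof
      show "f ` universe M \<subseteq> universe N" using f by (auto simp: A_def)
      show "universe N \<subseteq> f ` universe M"
      proof
        fix b assume "b \<in> universe N"
        then have "b \<in> h (type_of \<tau> N b) ` A M (type_of \<tau> N b)"
          using bij_betw_imp_surj_on[OF h[OF sub[of N b]]] by (simp add: A_def)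
        then show "b \<in> f ` universe M" by (auto simp: A_def f_def image_iff) metis
      qed
    qed
  qed
  moreover have "\<forall>P\<in>\<tau>. \<forall>a\<in>universe M. a \<in> interp M P \<longleftrightarrow> f a \<in> interp N P"
    using f by (fastforce simp: A_def type_of_def)
  ultimately show ?thesis by (auto simp: isomorphic_def)
qed

text \<open>In both models the counts sum to \<open>n\<close>, so lower bounds for all types leave
  no slack and must be equalities.\<close>

lemma isomorphic_iff_type_count_le:
  assumes "finite \<tau>" "is_model \<tau> n M" "is_model \<tau> n N"
  shows "isomorphic \<tau> N M \<longleftrightarrow>
    (\<forall>\<pi>\<in>realized_types \<tau> M. type_count \<tau> M \<pi> \<le> type_count \<tau> N \<pi>)"
proof
  assume le: "\<forall>\<pi>\<in>realized_types \<tau> M. type_count \<tau> M \<pi> \<le> type_count \<tau> N \<pi>"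
  have fin: "finite (universe M)" "finite (universe N)" "card (universe M) = card (universe N)"
    using assms by (simp_all add: is_model_def)
  have sum: "(\<Sum>\<pi>\<in>Pow \<tau>. type_count \<tau> K \<pi>) = card (universe K)"
    if "finite (universe K)" for K :: "'a model"
    using that assms(1) by (intro sum_type_count) (auto simp: realized_types_def)
  show "isomorphic \<tau> N M"
  proof (rule isomorphicI_type_count[OF fin(2,1)])
    fix \<pi> assume "\<pi> \<subseteq> \<tau>"
    \<comment> \<open>Types without a point in \<open>M\<close> satisfy the inequality trivially,
      which extends it to all of \<open>Pow \<tau>\<close>.\<close>
    moreover have "type_count \<tau> M \<rho> \<le> type_count \<tau> N \<rho>" if "\<rho> \<in> Pow \<tau>" for \<rho>
      using that le fin by (cases "0 < type_count \<tau> M \<rho>") (auto simp: realized_types_iff)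
    ultimately show "type_count \<tau> N \<pi> = type_count \<tau> M \<pi>"
      using sum_mono_inv[of "type_count \<tau> M" "Pow \<tau>" "type_count \<tau> N" \<pi>] assms(1) fin
      by (simp add: sum)
  qed
qed (simp add: isomorphic_type_count_eq)

text \<open>If \<open>N\<close> realizes no further type, its count of \<open>\<rho>\<close> is
  forced: it is \<open>n\<close> minus the other counts.\<close>

lemma isomorphic_iff_type_count_eq:
  assumes fin: "finite \<tau>" and M: "is_model \<tau> n M" and N: "is_model \<tau> n N"
    and \<rho>: "\<rho> \<in> realized_types \<tau> M"
  shows "isomorphic \<tau> N M \<longleftrightarrow> realized_types \<tau> N \<subseteq> realized_types \<tau> M \<and>
    (\<forall>\<pi>\<in>realized_types \<tau> M - {\<rho>}. type_count \<tau> N \<pi> = type_count \<tau> M \<pi>)"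
    (is "_ \<longleftrightarrow> ?R")
proof
  assume "isomorphic \<tau> N M"
  then have "type_count \<tau> N \<pi> = type_count \<tau> M \<pi>" for \<pi>
    by (rule isomorphic_type_count_eq)
  then show ?R using M N by (auto simp: realized_types_iff is_model_def)
next
  assume R: ?R
  define T where "T = realized_types \<tau> M"
  have T: "finite T" "T \<subseteq> Pow \<tau>"
    using fin by (auto simp: T_def realized_types_def)
  \<comment> \<open>\<open>T\<close> contains the realized types of both models, so both sums equal
    \<open>n\<close>.\<close>
  have "(\<Sum>\<pi>\<in>T. type_count \<tau> N \<pi>) = (\<Sum>\<pi>\<in>T. type_count \<tau> M \<pi>)"
    using T R M N by (simp add: sum_type_count T_def is_model_def)
  then have "type_count \<tau> N \<rho> = type_count \<tau> M \<rho>"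
    using R T(1) \<rho> sum.cong[of "T - {\<rho>}" "T - {\<rho>}" "type_count \<tau> N" "type_count \<tau> M"]
      sum.remove[of T \<rho> "type_count \<tau> N"] sum.remove[of T \<rho> "type_count \<tau> M"]
    by (simp add: T_def)
  then show "isomorphic \<tau> N M"
    using R by (subst isomorphic_iff_type_count_le[OF fin M N]) (metis Diff_iff order_refl singletonD)
qed

lemma is_model_finite: "is_model \<tau> n M \<Longrightarrow> finite (universe M)"
  by (simp add: is_model_def)

text \<open>Turns an inclusion of sets of types into a universal statement about points, the form
  that a formula expresses.\<close>

lemma realized_types_subset_iff:
  assumes "T \<subseteq> Pow \<tau>"
  shows "realized_types \<tau> M \<subseteq> T \<longleftrightarrow> (\<forall>a\<in>universe M. \<exists>\<pi>\<in>T. realizes \<tau> M a \<pi>)"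
proof -
  have "(\<exists>\<pi>\<in>T. realizes \<tau> M a \<pi>) \<longleftrightarrow> type_of \<tau> M a \<in> T" for a
    using assms by (metis PowD realizes_iff subsetD)
  then show ?thesis by (auto simp: realized_types_eq)
qed

lemma realized_types_isomorphic:
  assumes "isomorphic \<tau> N M" "finite (universe N)" "finite (universe M)"
  shows "realized_types \<tau> N = realized_types \<tau> M"
  using assms isomorphic_type_count_eq[OF assms(1)] by (simp add: set_eq_iff realized_types_iff)

subsection \<open>Formulas\<close>

text \<open>Negation pushed to the atoms. Since negations are not counted, it costs nothing.\<close>

primrec dual :: "'p fm \<Rightarrow> 'p fm" where
  "dual (Eq x y) = Neg (Eq x y)"
| "dual (Pred P x) = Neg (Pred P x)"
| "dual (Neg \<phi>) = \<phi>"
| "dual (Conj \<phi> \<psi>) = Disj (dual \<phi>) (dual \<psi>)"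
| "dual (Disj \<phi> \<psi>) = Conj (dual \<phi>) (dual \<psi>)"
| "dual (Exists x \<phi>) = Forall x (dual \<phi>)"
| "dual (Forall x \<phi>) = Exists x (dual \<phi>)"

lemma nnf_atomic: "atomic \<phi> \<Longrightarrow> nnf \<phi>"
  by (cases \<phi>) auto

lemma sat_dual [simp]: "sat M s (dual \<phi>) \<longleftrightarrow> \<not> sat M s \<phi>"
  by (induction \<phi> arbitrary: s) auto

lemma nnf_dual [simp]: "nnf \<phi> \<Longrightarrow> nnf (dual \<phi>)"
  by (induction \<phi>) (auto simp: nnf_atomic)

lemma free_vars_dual [simp]: "free_vars (dual \<phi>) = free_vars \<phi>"
  by (induction \<phi>) auto

lemma preds_dual [simp]: "preds (dual \<phi>) = preds \<phi>"
  by (induction \<phi>) auto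

lemma fm_size_dual [simp]: "fm_size (dual \<phi>) = fm_size \<phi>"
  by (induction \<phi>) auto

lemma foldr_Conj [simp]:
  "sat M s (foldr Conj \<phi>s \<phi>) \<longleftrightarrow> (\<forall>\<psi>\<in>set \<phi>s. sat M s \<psi>) \<and> sat M s \<phi>"
  "nnf (foldr Conj \<phi>s \<phi>) \<longleftrightarrow> (\<forall>\<psi>\<in>set \<phi>s. nnf \<psi>) \<and> nnf \<phi>"
  "free_vars (foldr Conj \<phi>s \<phi>) = (\<Union>\<psi>\<in>set \<phi>s. free_vars \<psi>) \<union> free_vars \<phi>"
  "preds (foldr Conj \<phi>s \<phi>) = (\<Union>\<psi>\<in>set \<phi>s. preds \<psi>) \<union> preds \<phi>"
  "fm_size (foldr Conj \<phi>s \<phi>) = (\<Sum>\<psi>\<leftarrow>\<phi>s. fm_size \<psi> + 1) + fm_size \<phi>"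
  by (induction \<phi>s) auto

lemma foldr_Forall [simp]:
  "nnf (foldr Forall xs \<phi>) \<longleftrightarrow> nnf \<phi>"
  "free_vars (foldr Forall xs \<phi>) = free_vars \<phi> - set xs"
  "preds (foldr Forall xs \<phi>) = preds \<phi>"
  "fm_size (foldr Forall xs \<phi>) = length xs + fm_size \<phi>"
  by (induction xs) auto

text \<open>A block of universal quantifiers amounts to one quantification over assignments
  \<open>g\<close>, so that all x_j can be chosen at once.\<close>

lemma sat_foldr_Forall:
  "sat M s (foldr Forall xs \<phi>) \<longleftrightarrow>
    (\<forall>g. g ` set xs \<subseteq> universe M \<longrightarrow> sat M (\<lambda>v. if v \<in> set xs then g v else s v) \<phi>)"
proof (induction xs arbitrary: s)
  case (Cons x xs)
  show ?case (is "_ \<longleftrightarrow> ?R")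
  proof
    assume *: "sat M s (foldr Forall (x # xs) \<phi>)"
    show ?R
    proof (intro allI impI)
      fix g assume g: "g ` set (x # xs) \<subseteq> universe M"
      then have "sat M (\<lambda>v. if v \<in> set xs then g v else (s(x := g x)) v) \<phi>"
        using * by (simp add: Cons.IH del: fun_upd_apply)
      also have "(\<lambda>v. if v \<in> set xs then g v else (s(x := g x)) v) =
          (\<lambda>v. if v \<in> set (x # xs) then g v else s v)"
        by auto
      finally show "sat M (\<lambda>v. if v \<in> set (x # xs) then g v else s v) \<phi>" .
    qed
  next
    assume R: ?R
    have "sat M (\<lambda>v. if v \<in> set xs then g v else (s(x := a)) v) \<phi>"
      if "a \<in> universe M" "g ` set xs \<subseteq> universe M" for a g
    proof -
      \<comment> \<open>If \<open>x\<close> recurs in \<open>xs\<close>, its inner quantifier wins,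
        so \<open>a\<close> is used only outside \<open>xs\<close>.\<close>
      define g' where "g' v = (if v \<in> set xs then g v else a)" for v
      have "g' ` set (x # xs) \<subseteq> universe M" using that by (auto simp: g'_def)
      with R have "sat M (\<lambda>v. if v \<in> set (x # xs) then g' v else s v) \<phi>" by blast
      also have "(\<lambda>v. if v \<in> set (x # xs) then g' v else s v) =
          (\<lambda>v. if v \<in> set xs then g v else (s(x := a)) v)"
        by (auto simp: g'_def)
      finally show ?thesis .
    qed
    then show "sat M s (foldr Forall (x # xs) \<phi>)"
      by (simp add: Cons.IH del: fun_upd_apply)
  qed
qed simp

section \<open>Type formulas and their nesting\<close>

definition literal :: "'p set \<Rightarrow> nat \<Rightarrow> 'p \<Rightarrow> 'p fm" where
  "literal \<pi> x P = (if P \<in> \<pi> then Pred P x else Neg (Pred P x))"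

lemma literal_simps [simp]:
  "sat M s (literal \<pi> x P) \<longleftrightarrow> (s x \<in> interp M P \<longleftrightarrow> P \<in> \<pi>)"
  "nnf (literal \<pi> x P)" "free_vars (literal \<pi> x P) = {x}" "preds (literal \<pi> x P) = {P}"
  "fm_size (literal \<pi> x P) = 1"
  by (auto simp: literal_def)

text \<open>The syntax has no constant for truth, so the conjunction ends in the literal of a
  distinguished symbol \<open>P\<close>.\<close>

definition type_fm :: "'p \<Rightarrow> 'p list \<Rightarrow> 'p set \<Rightarrow> nat \<Rightarrow> 'p fm" where
  "type_fm P Ps \<pi> x = foldr Conj (map (literal \<pi> x) Ps) (literal \<pi> x P)"

lemma type_fm_simps [simp]:
  "sat M s (type_fm P Ps \<pi> x) \<longleftrightarrow> realizes (set (P # Ps)) M (s x) \<pi>"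
  "nnf (type_fm P Ps \<pi> x)" "free_vars (type_fm P Ps \<pi> x) = {x}"
  "preds (type_fm P Ps \<pi> x) = set (P # Ps)"
  "fm_size (type_fm P Ps \<pi> x) = 2 * length Ps + 1"
  by (auto simp: type_fm_def realizes_def comp_def sum_list_triv)

text \<open>The variables \<open>z\<close>, \<open>y\<close>, \<open>x\<^sub>1, x\<^sub>2, \<dots>\<close> are numbered \<open>0\<close>, \<open>1\<close>, \<open>2, 3, \<dots>\<close>. The part of the formula
  starting with \<open>y \<noteq> x\<^sub>l\<^sub>o\<^sub>+\<^sub>1\<close>:\<close>

primrec chain :: "'p \<Rightarrow> 'p list \<Rightarrow> ('p set \<Rightarrow> nat) \<Rightarrow> nat \<Rightarrow> 'p set list \<Rightarrow> 'p fm" where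
  "chain P Ps d lo [] = Neg (Eq 1 1)"
| "chain P Ps d lo (\<pi> # L) = foldr Conj (map (\<lambda>j. Neg (Eq 1 (j + 2))) [lo..<d \<pi>])
     (Disj (Conj (type_fm P Ps \<pi> 1) (type_fm P Ps \<pi> 0)) (chain P Ps d (d \<pi>) L))"

text \<open>The literals in front distribute over the nested disjunction: as thresholds ascend, a
  later type inherits the literals of all earlier ones. The closing \<open>Neg (Eq 1 1)\<close> acts
  as the empty disjunction.\<close>

lemma sat_chain:
  assumes "sorted (map d L)" "\<forall>\<pi>\<in>set L. lo \<le> d \<pi>"
  shows "sat M s (chain P Ps d lo L) \<longleftrightarrow>
    (\<exists>\<pi>\<in>set L. realizes (set (P # Ps)) M (s 1) \<pi> \<and> realizes (set (P # Ps)) M (s 0) \<pi> \<and>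
      (\<forall>j\<in>{lo..<d \<pi>}. s 1 \<noteq> s (j + 2)))"
  using assms
proof (induction L arbitrary: lo)
  case (Cons \<pi> L)
  define R where "R = (\<lambda>\<rho>. realizes (set (P # Ps)) M (s 1) \<rho> \<and> realizes (set (P # Ps)) M (s 0) \<rho>)"
  define A where "A = (\<lambda>i k. \<forall>j\<in>{i..<k}. s 1 \<noteq> s (j + 2))"
  have IH: "sat M s (chain P Ps d (d \<pi>) L) \<longleftrightarrow> (\<exists>\<rho>\<in>set L. R \<rho> \<and> A (d \<pi>) (d \<rho>))"
    using Cons.prems Cons.IH[of "d \<pi>"] by (simp add: R_def A_def)
  have "A lo (d \<rho>) \<longleftrightarrow> A lo (d \<pi>) \<and> A (d \<pi>) (d \<rho>)" if "\<rho> \<in> set L" for \<rho>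
  proof -
    \<comment> \<open>Here \<open>lo \<le> d \<pi> \<le> d \<rho>\<close> makes the intervals fit
      together.\<close>
    have "{lo..<d \<rho>} = {lo..<d \<pi>} \<union> {d \<pi>..<d \<rho>}"
      using Cons.prems that by auto
    then show ?thesis unfolding A_def by blast
  qed
  then have split: "(\<exists>\<rho>\<in>set L. R \<rho> \<and> A lo (d \<rho>)) \<longleftrightarrow>
      A lo (d \<pi>) \<and> (\<exists>\<rho>\<in>set L. R \<rho> \<and> A (d \<pi>) (d \<rho>))"
    by (auto simp only:)
  have "sat M s (chain P Ps d lo (\<pi> # L)) \<longleftrightarrow>
      A lo (d \<pi>) \<and> (R \<pi> \<or> sat M s (chain P Ps d (d \<pi>) L))"
    by (auto simp: A_def R_def)
  also have "\<dots> \<longleftrightarrow> (\<exists>\<rho>\<in>set (\<pi> # L). R \<rho> \<and> A lo (d \<rho>))"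
    unfolding IH list.set(2)[of \<pi>] bex_simps(5) split by blast
  finally show ?case by (simp only: R_def A_def conj_assoc)
qed simp

text \<open>Each literal occurs once and costs 2 with its conjunction, so the stretches telescope to
  at most \<open>2 * (m - lo)\<close>. A type costs two type formulas, a conjunction and a
  disjunction; the final 1 is the closing falsity.\<close>

lemma fm_size_chain:
  assumes "sorted (map d L)" "\<forall>\<pi>\<in>set L. lo \<le> d \<pi> \<and> d \<pi> \<le> m" "lo \<le> m"
  shows "fm_size (chain P Ps d lo L) \<le> 2 * (m - lo) + length L * (4 * length Ps + 4) + 1"
  using assms
proof (induction L arbitrary: lo)
  case (Cons \<pi> L)
  have "fm_size (chain P Ps d (d \<pi>) L)
      \<le> 2 * (m - d \<pi>) + length L * (4 * length Ps + 4) + 1"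
    using Cons.prems by (intro Cons.IH) auto
  moreover have "m - lo = (m - d \<pi>) + (d \<pi> - lo)" using Cons.prems by auto
  ultimately show ?case
    by (simp add: comp_def sum_list_triv algebra_simps)
qed simp

lemma nnf_chain: "nnf (chain P Ps d lo L)"
  by (induction L arbitrary: lo) auto

lemma preds_chain: "preds (chain P Ps d lo L) \<subseteq> set (P # Ps)"
  by (induction L arbitrary: lo) auto

lemma free_vars_chain:
  "\<forall>\<pi>\<in>set L. d \<pi> \<le> m \<Longrightarrow> free_vars (chain P Ps d lo L) \<subseteq> {..<m + 2}"
proof (induction L arbitrary: lo)
  case (Cons \<pi> L)
  then show ?case using Cons.IH[of "d \<pi>"] by auto
qed simp

section \<open>Exceeding thresholds, and lower bounds as one sentence\<close>

definition exceeds_fm :: "'p \<Rightarrow> 'p list \<Rightarrow> ('p set \<Rightarrow> nat) \<Rightarrow> nat \<Rightarrow> 'p set list \<Rightarrow> 'p fm" where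
  "exceeds_fm P Ps d m L = foldr Forall [2..<m + 2] (Exists 1 (chain P Ps d 0 L))"

lemma exceeds_fm_syntax:
  "nnf (exceeds_fm P Ps d m L)" "preds (exceeds_fm P Ps d m L) \<subseteq> set (P # Ps)"
  using preds_chain[of P Ps d 0 L] by (simp_all add: exceeds_fm_def nnf_chain)

lemma free_vars_exceeds_fm:
  assumes "\<forall>\<pi>\<in>set L. d \<pi> \<le> m"
  shows "free_vars (exceeds_fm P Ps d m L) \<subseteq> {0}"
proof
  fix v assume "v \<in> free_vars (exceeds_fm P Ps d m L)"
  then have "v < m + 2" "v \<noteq> 1" "\<not> (2 \<le> v \<and> v < m + 2)"
    using free_vars_chain[OF assms, of P Ps 0] by (auto simp: exceeds_fm_def simp del: upt_Suc)
  then show "v \<in> {0}" by auto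
qed

text \<open>Besides its literal and conjunction, each x_j costs one quantifier, which makes the
  factor 3.\<close>

lemma fm_size_exceeds_fm:
  assumes "sorted (map d L)" "\<forall>\<pi>\<in>set L. d \<pi> \<le> m"
  shows "fm_size (exceeds_fm P Ps d m L) \<le> 3 * m + length L * (4 * length Ps + 4) + 2"
  using fm_size_chain[of d L 0 m P Ps] assms by (simp add: exceeds_fm_def del: upt_Suc)

text \<open>If the type of \<open>z\<close> has more than \<open>d \<pi>\<close> points, no choice
  of \<open>d \<pi>\<close> points exhausts it, so some \<open>y\<close> remains. Otherwise the x_j
  can list all its points, leaving no \<open>y\<close>.\<close>

lemma sat_exceeds_fm:
  assumes fin: "finite (universe M)" and sorted: "sorted (map d L)"
    and m: "\<forall>\<pi>\<in>set L. d \<pi> \<le> m" and s0: "s 0 \<in> universe M"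
  shows "sat M s (exceeds_fm P Ps d m L) \<longleftrightarrow>
    (\<exists>\<pi>\<in>set L. realizes (set (P # Ps)) M (s 0) \<pi> \<and> d \<pi> < type_count (set (P # Ps)) M \<pi>)"
    (is "?L \<longleftrightarrow> ?R")
proof -
  define R where "R = realizes (set (P # Ps)) M"
  have sat: "?L \<longleftrightarrow> (\<forall>g. g ` {2..<m + 2} \<subseteq> universe M \<longrightarrow>
     (\<exists>b\<in>universe M. \<exists>\<pi>\<in>set L. R b \<pi> \<and> R (s 0) \<pi> \<and>
       (\<forall>j<d \<pi>. b \<noteq> g (j + 2))))"
  proof -
    have "sat M (\<lambda>v. if v \<in> {2..<m + 2} then g v else s v) (Exists 1 (chain P Ps d 0 L)) \<longleftrightarrow>
      (\<exists>b\<in>universe M. \<exists>\<pi>\<in>set L. R b \<pi> \<and> R (s 0) \<pi> \<and> (\<forall>j<d \<pi>. b \<noteq> g (j + 2)))" for g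
      unfolding sat.simps
    proof (rule bex_cong[OF refl])
      fix b
      define s' where "s' = (\<lambda>v. if v \<in> {2..<m + 2} then g v else s v)(1 := b)"
      have s': "s' 0 = s 0" "s' 1 = b" by (simp_all add: s'_def)
      show "sat M s' (chain P Ps d 0 L) \<longleftrightarrow>
          (\<exists>\<pi>\<in>set L. R b \<pi> \<and> R (s 0) \<pi> \<and> (\<forall>j<d \<pi>. b \<noteq> g (j + 2)))"
      proof (subst sat_chain[OF sorted], simp, rule bex_cong[OF refl])
        fix \<pi> assume \<pi>: "\<pi> \<in> set L"
        \<comment> \<open>\<open>j < d \<pi> \<le> m\<close> puts \<open>j + 2\<close> inside the
          quantified block, and it differs from 1, the variable set to \<open>b\<close>.\<close>
        have "s' (j + 2) = g (j + 2)" if "j < d \<pi>" for j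
          using bspec[OF m \<pi>] that by (simp add: s'_def)
        then have "(\<forall>j\<in>{0..<d \<pi>}. s' 1 \<noteq> s' (j + 2)) \<longleftrightarrow> (\<forall>j<d \<pi>. b \<noteq> g (j + 2))"
          unfolding s'(2) by (metis atLeastLessThan_iff le0)
        then show "realizes (set (P # Ps)) M (s' 1) \<pi> \<and> realizes (set (P # Ps)) M (s' 0) \<pi> \<and>
            (\<forall>j\<in>{0..<d \<pi>}. s' 1 \<noteq> s' (j + 2)) \<longleftrightarrow>
          R b \<pi> \<and> R (s 0) \<pi> \<and> (\<forall>j<d \<pi>. b \<noteq> g (j + 2))"
          by (simp only: R_def s')
      qed
    qed
    then show ?thesis
      by (simp only: exceeds_fm_def sat_foldr_Forall set_upt)
  qed
  show ?thesis
  proof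
    assume ?R
    then obtain \<pi> where \<pi>: "\<pi> \<in> set L" "R (s 0) \<pi>" "d \<pi> < card {a \<in> universe M. R a \<pi>}"
      by (auto simp: R_def type_count_def)
    show ?L unfolding sat
    proof (intro allI impI)
      fix g :: "nat \<Rightarrow> nat"
      have "finite ((\<lambda>j. g (j + 2)) ` {..<d \<pi>})" by simp
      moreover have "card ((\<lambda>j. g (j + 2)) ` {..<d \<pi>}) \<le> d \<pi>"
        using card_image_le[of "{..<d \<pi>}"] by simp
      ultimately have "\<not> {a \<in> universe M. R a \<pi>} \<subseteq> (\<lambda>j. g (j + 2)) ` {..<d \<pi>}"
        using \<pi>(3) card_mono[of "(\<lambda>j. g (j + 2)) ` {..<d \<pi>}" "{a \<in> universe M. R a \<pi>}"] by linarith
      then obtain b where "b \<in> universe M" "R b \<pi>" "b \<notin> (\<lambda>j. g (j + 2)) ` {..<d \<pi>}"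
        by auto
      then show "\<exists>b\<in>universe M. \<exists>\<pi>\<in>set L. R b \<pi> \<and> R (s 0) \<pi> \<and> (\<forall>j<d \<pi>. b \<noteq> g (j + 2))"
        using \<pi> by auto
    qed
  next
    assume ?L
    show ?R
    proof (rule ccontr)
      assume "\<not> ?R"
      \<comment> \<open>The points agreeing with \<open>z\<close>: one set that serves for every
        \<open>\<pi>\<close> realized by \<open>z\<close>.\<close>
      define F where "F = {a \<in> universe M. \<forall>Q\<in>set (P # Ps). a \<in> interp M Q \<longleftrightarrow> s 0 \<in> interp M Q}"
      have F: "{a \<in> universe M. R a \<pi>} = F" if "R (s 0) \<pi>" for \<pi>
        using that by (auto simp: F_def R_def realizes_def)
      have le: "card F \<le> d \<pi>" if "\<pi> \<in> set L" "R (s 0) \<pi>" for \<pi>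
        using \<open>\<not> ?R\<close> that F[OF that(2)] by (auto simp: R_def type_count_def not_less)
      have "finite F" using fin by (simp add: F_def)
      then obtain e where e: "bij_betw e {0..<card F} F"
        using ex_bij_betw_nat_finite by blast
      \<comment> \<open>The x_j, numbered from 2, list \<open>F\<close>; any left over take the
        value \<open>s 0\<close>, which only has to lie in the universe.\<close>
      define g where "g v = (if v - 2 < card F then e (v - 2) else s 0)" for v
      have "g ` {2..<m + 2} \<subseteq> universe M"
        using bij_betwE[OF e] s0 by (auto simp: g_def F_def)
      with \<open>?L\<close>[unfolded sat] obtain b \<pi> where b: "b \<in> universe M" "\<pi> \<in> set L" "R b \<pi>" "R (s 0) \<pi>"
          "\<forall>j<d \<pi>. b \<noteq> g (j + 2)"
        by blast
      \<comment> \<open>\<open>b\<close> has the type of \<open>z\<close>, hence lies in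
        \<open>F\<close> and equals some x_j listed before position
        \<open>card F \<le> d \<pi>\<close>.\<close>
      have "b \<in> e ` {0..<card F}"
        using b F[OF b(4)] bij_betw_imp_surj_on[OF e] by auto
      then obtain j where "j < card F" "b = e j" by auto
      moreover from this have "b \<noteq> g (j + 2)" using b(5) le[OF b(2,4)] by auto
      ultimately show False by (simp add: g_def)
    qed
  qed
qed

text \<open>The disjunct \<open>\<gamma>\<close> exempts those \<open>z\<close> whose type is not in \<open>L\<close>.\<close>

definition at_least_fm ::
    "'p \<Rightarrow> 'p list \<Rightarrow> ('p set \<Rightarrow> nat) \<Rightarrow> nat \<Rightarrow> 'p set list \<Rightarrow> 'p fm \<Rightarrow> 'p fm" where
  "at_least_fm P Ps c m L \<gamma> = foldr Conj (map (\<lambda>\<pi>. Exists 0 (type_fm P Ps \<pi> 0)) L)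
     (Forall 0 (Disj \<gamma> (exceeds_fm P Ps (\<lambda>\<pi>. c \<pi> - 1) (m - 1) L)))"

lemma sorted_map_diff: "sorted (map c L) \<Longrightarrow> sorted (map (\<lambda>\<pi>. c \<pi> - k) L)" for c :: "_ \<Rightarrow> nat"
  by (induction L) (auto simp: diff_le_mono)

lemma sentence_at_least_fm:
  assumes "nnf \<gamma>" "preds \<gamma> \<subseteq> set (P # Ps)" "free_vars \<gamma> \<subseteq> {0}" "\<forall>\<pi>\<in>set L. c \<pi> \<le> m"
  shows "sentence (set (P # Ps)) (at_least_fm P Ps c m L \<gamma>)"
proof -
  have "\<forall>\<pi>\<in>set L. c \<pi> - 1 \<le> m - 1" using assms(4) by auto
  from free_vars_exceeds_fm[OF this, of P Ps] show ?thesis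
    using exceeds_fm_syntax[of P Ps "\<lambda>\<pi>. c \<pi> - 1" "m - 1" L] assms
    by (auto simp: sentence_def at_least_fm_def)
qed

text \<open>Only \<open>m - 1\<close> variables x_j are used, and the 3 saved absorb all but 1 of
  the constant costs. Per type, the existence conjunct adds
  \<open>2 * length Ps + 3\<close>.\<close>

lemma fm_size_at_least_fm:
  assumes "sorted (map c L)" "\<forall>\<pi>\<in>set L. c \<pi> \<le> m" "1 \<le> m"
  shows "fm_size (at_least_fm P Ps c m L \<gamma>)
    \<le> 3 * m + length L * (6 * length Ps + 7) + fm_size \<gamma> + 1"
proof -
  have "\<forall>\<pi>\<in>set L. c \<pi> - 1 \<le> m - 1" using assms(2) by auto
  from fm_size_exceeds_fm[OF sorted_map_diff[OF assms(1)] this, of P Ps] show ?thesis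
    using assms(3) by (simp add: at_least_fm_def comp_def sum_list_triv algebra_simps)
qed

text \<open>Exceeding \<open>c \<pi> - 1\<close> means reaching \<open>c \<pi>\<close>. The
  universal part constrains only types of existing points, hence the existence conjuncts;
  \<open>\<gamma>\<close> fails on the types in \<open>L\<close> and so cannot exempt them.\<close>

lemma sat_at_least_fm:
  assumes \<tau>: "\<tau> = set (P # Ps)" and fin: "finite (universe M)" and sorted: "sorted (map c L)"
    and c: "\<forall>\<pi>\<in>set L. 1 \<le> c \<pi> \<and> c \<pi> \<le> m" and L: "set L \<subseteq> Pow \<tau>"
    and \<gamma>: "\<And>a \<pi>. a \<in> universe M \<Longrightarrow> \<pi> \<in> set L \<Longrightarrow> realizes \<tau> M a \<pi> \<Longrightarrow>
      \<not> sat M (s(0 := a)) \<gamma>"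
  shows "sat M s (at_least_fm P Ps c m L \<gamma>) \<longleftrightarrow>
    (\<forall>\<pi>\<in>set L. c \<pi> \<le> type_count \<tau> M \<pi>) \<and>
    (\<forall>a\<in>universe M. sat M (s(0 := a)) \<gamma> \<or> (\<exists>\<pi>\<in>set L. realizes \<tau> M a \<pi>))"
proof -
  have d: "\<forall>\<pi>\<in>set L. c \<pi> - 1 \<le> m - 1" using c by auto
  \<comment> \<open>\<open>1 \<le> c \<pi>\<close> makes the truncated subtraction exact.\<close>
  have less: "c \<pi> - 1 < k \<longleftrightarrow> c \<pi> \<le> k" if "\<pi> \<in> set L" for \<pi> k
    using c that by fastforce
  have "sat M (s(0 := a)) (exceeds_fm P Ps (\<lambda>\<pi>. c \<pi> - 1) (m - 1) L) \<longleftrightarrow>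
      (\<exists>\<pi>\<in>set L. realizes \<tau> M a \<pi> \<and> c \<pi> \<le> type_count \<tau> M \<pi>)"
    if "a \<in> universe M" for a
    using that less sat_exceeds_fm[OF fin sorted_map_diff[OF sorted] d, of "s(0 := a)" P Ps]
    by (auto simp: \<tau>)
  then have sat: "sat M s (at_least_fm P Ps c m L \<gamma>) \<longleftrightarrow>
      (\<forall>\<pi>\<in>set L. \<exists>a\<in>universe M. realizes \<tau> M a \<pi>) \<and>
      (\<forall>a\<in>universe M. sat M (s(0 := a)) \<gamma> \<or>
        (\<exists>\<pi>\<in>set L. realizes \<tau> M a \<pi> \<and> c \<pi> \<le> type_count \<tau> M \<pi>))"
    by (simp add: at_least_fm_def \<tau>)
  have unique: "\<pi> = \<pi>'" if "\<pi> \<in> set L" "\<pi>' \<in> set L" "realizes \<tau> M a \<pi>"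
      "realizes \<tau> M a \<pi>'" for a \<pi> \<pi>'
    using that L by (metis PowD realizes_iff subsetD)
  have realized: "\<exists>a\<in>universe M. realizes \<tau> M a \<pi>"
    if "\<pi> \<in> set L" "c \<pi> \<le> type_count \<tau> M \<pi>" for \<pi>
    using that c type_count_pos_iff[OF fin, of \<tau> \<pi>] by fastforce
  show ?thesis unfolding sat
  proof (rule iffI; elim conjE)
    assume ex: "\<forall>\<pi>\<in>set L. \<exists>a\<in>universe M. realizes \<tau> M a \<pi>"
      and all: "\<forall>a\<in>universe M. sat M (s(0 := a)) \<gamma> \<or>
        (\<exists>\<pi>\<in>set L. realizes \<tau> M a \<pi> \<and> c \<pi> \<le> type_count \<tau> M \<pi>)"
    have "c \<pi> \<le> type_count \<tau> M \<pi>" if \<pi>: "\<pi> \<in> set L" for \<pi>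
    proof -
      obtain a where a: "a \<in> universe M" "realizes \<tau> M a \<pi>" using ex \<pi> by blast
      then obtain \<pi>' where \<pi>': "\<pi>' \<in> set L" "realizes \<tau> M a \<pi>'"
          "c \<pi>' \<le> type_count \<tau> M \<pi>'"
        using all \<gamma>[OF a(1) \<pi> a(2)] by blast
      \<comment> \<open>\<open>all\<close> yields only some type of \<open>a\<close> in
        \<open>L\<close>; by uniqueness it is \<open>\<pi>\<close>.\<close>
      from unique[OF \<pi> \<pi>'(1) a(2) \<pi>'(2)] \<pi>'(3) show ?thesis by simp
    qed
    then show "(\<forall>\<pi>\<in>set L. c \<pi> \<le> type_count \<tau> M \<pi>) \<and>
      (\<forall>a\<in>universe M. sat M (s(0 := a)) \<gamma> \<or> (\<exists>\<pi>\<in>set L. realizes \<tau> M a \<pi>))"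
      using all by blast
  qed (use realized in blast)
qed

subsection \<open>Upper bounds\<close>

lemma description_complexity_le:
  "defines_model \<tau> n \<phi> M \<Longrightarrow> fm_size \<phi> \<le> b \<Longrightarrow> description_complexity \<tau> n M \<le> enat b"
  unfolding description_complexity_def by (rule INF_lower2[of \<phi>]) auto

lemma defines_modelI:
  assumes "n \<ge> 1" "sentence \<tau> \<phi>"
    and "\<And>M' s. is_model \<tau> n M' \<Longrightarrow> sat M' s \<phi> \<longleftrightarrow> isomorphic \<tau> M' M"
  shows "defines_model \<tau> n \<phi> M"
  unfolding defines_model_def
proof (intro conjI allI impI)
  fix M' assume M': "is_model \<tau> n M'"
  \<comment> \<open>A nonempty universe admits an assignment, here the constant 1, so
    \<open>satisfies\<close> is not vacuously true.\<close>
  have "range (\<lambda>_. 1) \<subseteq> universe M'" using M' assms(1) by (auto simp: is_model_def)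
  then show "satisfies M' \<phi> \<longleftrightarrow> isomorphic \<tau> M' M"
    unfolding satisfies_def using assms(3)[OF M'] by blast
qed fact

text \<open>With falsity as \<open>\<gamma>\<close> no point is exempt. Lower bounds for all
  realized types suffice because both models have \<open>n\<close> points.\<close>

lemma description_complexity_le_max:
  assumes \<tau>: "\<tau> = set (P # Ps)" and n: "n \<ge> 1" and M: "is_model \<tau> n M"
    and L: "set L = realized_types \<tau> M" "sorted (map (type_count \<tau> M) L)"
    and m: "\<forall>\<pi>\<in>set L. type_count \<tau> M \<pi> \<le> m" "1 \<le> m"
  shows "description_complexity \<tau> n M \<le> enat (3 * m + length L * (6 * length Ps + 7) + 2)"
proof -
  define \<phi> where "\<phi> = at_least_fm P Ps (type_count \<tau> M) m L (Neg (Eq 0 0))"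
  have fin: "finite \<tau>" by (simp add: \<tau>)
  have sub: "realized_types \<tau> M \<subseteq> Pow \<tau>" by (auto simp: realized_types_def)
  have pos: "\<forall>\<pi>\<in>set L. 1 \<le> type_count \<tau> M \<pi> \<and> type_count \<tau> M \<pi> \<le> m"
    using m is_model_finite[OF M] by (auto simp: L realized_types_iff)
  have "defines_model \<tau> n \<phi> M"
  proof (rule defines_modelI[OF n])
    show "sentence \<tau> \<phi>"
      using m unfolding \<phi>_def \<tau> by (intro sentence_at_least_fm) auto
    fix M' s assume M': "is_model \<tau> n M'"
    have "sat M' s \<phi> \<longleftrightarrow> (\<forall>\<pi>\<in>set L. type_count \<tau> M \<pi> \<le> type_count \<tau> M' \<pi>) \<and>
        realized_types \<tau> M' \<subseteq> realized_types \<tau> M"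
      using sat_at_least_fm[OF \<tau> is_model_finite[OF M'] L(2) pos, of s "Neg (Eq 0 0)"] sub
      by (simp add: \<phi>_def L realized_types_subset_iff)
    then show "sat M' s \<phi> \<longleftrightarrow> isomorphic \<tau> M' M"
      using isomorphic_iff_type_count_le[OF fin M M']
        realized_types_isomorphic[OF _ is_model_finite[OF M'] is_model_finite[OF M]]
      unfolding L by blast
  qed
  moreover have "fm_size \<phi> \<le> 3 * m + length L * (6 * length Ps + 7) + 2"
    using fm_size_at_least_fm[OF L(2) m, of P Ps "Neg (Eq 0 0)"] by (simp add: \<phi>_def)
  ultimately show ?thesis by (rule description_complexity_le)
qed

text \<open>\<open>\<gamma>\<close> exempts the points of type \<open>\<rho>\<close>. The dualized
  existential bounds the other counts from above, and the count of \<open>\<rho>\<close> is then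
  forced.\<close>

lemma description_complexity_le_second:
  assumes \<tau>: "\<tau> = set (P # Ps)" and n: "n \<ge> 1" and M: "is_model \<tau> n M"
    and \<rho>: "\<rho> \<in> realized_types \<tau> M"
    and L: "set L = realized_types \<tau> M - {\<rho>}" "sorted (map (type_count \<tau> M) L)"
    and m: "\<forall>\<pi>\<in>set L. type_count \<tau> M \<pi> \<le> m" "1 \<le> m"
  shows "description_complexity \<tau> n M
    \<le> enat (6 * m + length L * (10 * length Ps + 11) + (2 * length Ps + 6))"
proof -
  define \<phi> where "\<phi> = Conj (at_least_fm P Ps (type_count \<tau> M) m L (type_fm P Ps \<rho> 0))
    (dual (Exists 0 (exceeds_fm P Ps (type_count \<tau> M) m L)))"
  have fin: "finite \<tau>" by (simp add: \<tau>)
  have sub: "realized_types \<tau> M \<subseteq> Pow \<tau>" by (auto simp: realized_types_def)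
  have pos: "\<forall>\<pi>\<in>set L. 1 \<le> type_count \<tau> M \<pi> \<and> type_count \<tau> M \<pi> \<le> m"
    using m is_model_finite[OF M] by (auto simp: L realized_types_iff)
  have "defines_model \<tau> n \<phi> M"
  proof (rule defines_modelI[OF n])
    have "sentence \<tau> (at_least_fm P Ps (type_count \<tau> M) m L (type_fm P Ps \<rho> 0))"
      using m unfolding \<tau> by (intro sentence_at_least_fm) auto
    then show "sentence \<tau> \<phi>"
      using exceeds_fm_syntax[of P Ps "type_count \<tau> M" m L] free_vars_exceeds_fm[OF m(1), of P Ps]
      by (auto simp: sentence_def \<phi>_def \<tau>)
    fix M' s assume M': "is_model \<tau> n M'"
    note fin' = is_model_finite[OF M']
    have unique: "\<not> realizes \<tau> M' a \<rho>" if "\<pi> \<in> set L" "realizes \<tau> M' a \<pi>" for \<pi> a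
      using that sub \<rho> unfolding L by (metis Diff_iff PowD insertI1 realizes_iff subsetD)
    have "sat M' s (at_least_fm P Ps (type_count \<tau> M) m L (type_fm P Ps \<rho> 0)) \<longleftrightarrow>
        (\<forall>\<pi>\<in>set L. type_count \<tau> M \<pi> \<le> type_count \<tau> M' \<pi>) \<and>
        (\<forall>a\<in>universe M'. realizes \<tau> M' a \<rho> \<or> (\<exists>\<pi>\<in>set L. realizes \<tau> M' a \<pi>))"
    proof -
      have "set L \<subseteq> Pow \<tau>" using sub unfolding L by blast
      from sat_at_least_fm[OF \<tau> fin' L(2) pos this, of s "type_fm P Ps \<rho> 0"] unique show ?thesis
        by (simp add: \<tau>)
    qed
    moreover have "(\<forall>a\<in>universe M'. realizes \<tau> M' a \<rho> \<or> (\<exists>\<pi>\<in>set L. realizes \<tau> M' a \<pi>)) \<longleftrightarrow>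
        realized_types \<tau> M' \<subseteq> realized_types \<tau> M"
      unfolding realized_types_subset_iff[OF sub] L using \<rho> by blast
    moreover have "sat M' s (dual (Exists 0 (exceeds_fm P Ps (type_count \<tau> M) m L))) \<longleftrightarrow>
        (\<forall>\<pi>\<in>set L. type_count \<tau> M' \<pi> \<le> type_count \<tau> M \<pi>)"
    proof -
      have "sat M' s (dual (Exists 0 (exceeds_fm P Ps (type_count \<tau> M) m L))) \<longleftrightarrow>
          \<not> (\<exists>a\<in>universe M'. \<exists>\<pi>\<in>set L. realizes \<tau> M' a \<pi> \<and>
            type_count \<tau> M \<pi> < type_count \<tau> M' \<pi>)"
        using sat_exceeds_fm[OF fin' L(2) m(1), of "s(0 := _)" P Ps]
        by (simp add: \<tau>)
      also have "\<dots> \<longleftrightarrow> (\<forall>\<pi>\<in>set L. \<not> type_count \<tau> M \<pi> < type_count \<tau> M' \<pi>)"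
      proof (intro iffI notI ballI)
        fix \<pi> assume no: "\<not> (\<exists>a\<in>universe M'. \<exists>\<pi>\<in>set L. realizes \<tau> M' a \<pi> \<and>
            type_count \<tau> M \<pi> < type_count \<tau> M' \<pi>)"
          and \<pi>: "\<pi> \<in> set L" "type_count \<tau> M \<pi> < type_count \<tau> M' \<pi>"
        \<comment> \<open>A count above a threshold is positive, so the type has a point, which can
          serve as \<open>z\<close>.\<close>
        then have "0 < type_count \<tau> M' \<pi>" by simp
        then show False using no \<pi> unfolding type_count_pos_iff[OF fin'] by blast
      qed blast
      finally show ?thesis by (simp only: not_less)
    qed
    ultimately have "sat M' s \<phi> \<longleftrightarrow> realized_types \<tau> M' \<subseteq> realized_types \<tau> M \<and>
        (\<forall>\<pi>\<in>set L. type_count \<tau> M' \<pi> = type_count \<tau> M \<pi>)"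
      unfolding \<phi>_def sat.simps(4) eq_iff[of "type_count \<tau> _ _"] by blast
    then show "sat M' s \<phi> \<longleftrightarrow> isomorphic \<tau> M' M"
      unfolding isomorphic_iff_type_count_eq[OF fin M M' \<rho>] L .
  qed
  moreover have "fm_size \<phi> \<le> 6 * m + length L * (10 * length Ps + 11) + (2 * length Ps + 6)"
    using fm_size_at_least_fm[OF L(2) m, of P Ps "type_fm P Ps \<rho> 0"]
      fm_size_exceeds_fm[OF L(2) m(1), of P Ps]
    by (simp add: \<phi>_def algebra_simps)
  ultimately show ?thesis by (rule description_complexity_le)
qed

text \<open>Without symbols the identity is an isomorphism between any two models of size
  \<open>n\<close>, so a valid sentence defines \<open>M\<close>. The case is separate because type
  formulas require a symbol.\<close>

lemma description_complexity_empty_vocabulary: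
  assumes "n \<ge> 1" "is_model {} n M"
  shows "description_complexity {} n M \<le> enat 2"
proof (rule description_complexity_le)
  show "defines_model {} n (Forall 0 (Eq 0 0)) M"
    using assms
    by (intro defines_modelI) (auto simp: sentence_def isomorphic_def is_model_def intro: bij_betw_id)
qed simp

section \<open>Fitting both bounds to the constant\<close>

theorem theorem1:
  fixes \<tau> :: "'p set" and M :: "'p model" and n l :: nat and \<pi> :: "nat \<Rightarrow> 'p set"
  assumes "finite \<tau>"
    and "n \<ge> 1"
    and "is_model \<tau> n M"
    and "bij_betw \<pi> {1..l} (realized_types \<tau> M)"
    and "\<forall>i j. 1 \<le> i \<and> i \<le> j \<and> j \<le> l \<longrightarrow> type_count \<tau> M (\<pi> i) \<le> type_count \<tau> M (\<pi> j)"
  shows "description_complexity \<tau> n M \<le>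
    enat (if l = 1 then 3 * type_count \<tau> M (\<pi> l) + c_const \<tau>
          else min (3 * type_count \<tau> M (\<pi> l) + c_const \<tau>)
                   (6 * type_count \<tau> M (\<pi> (l - 1)) + c_const \<tau>))"
proof -
  define T where "T = realized_types \<tau> M"
  define c where "c = type_count \<tau> M"
  have T: "finite T" "T \<subseteq> Pow \<tau>"
    using \<open>finite \<tau>\<close> by (auto simp: T_def realized_types_def)
  have image: "\<pi> ` {1..l} = T"
    using assms(4) by (simp add: T_def bij_betw_imp_surj_on)
  have inj: "inj_on \<pi> {1..l}"
    using assms(4) by (rule bij_betw_imp_inj_on)
  have "T \<noteq> {}"
    using assms(2,3) by (auto simp: T_def realized_types_eq is_model_def)
  then have "l \<ge> 1" using image by auto
  have card: "l \<le> 2 ^ card \<tau>"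
  proof -
    have "card T = l" using card_image[OF inj] unfolding image by simp
    then show ?thesis using card_mono[OF _ T(2)] \<open>finite \<tau>\<close> by (simp add: card_Pow)
  qed
  have mono: "c (\<pi> i) \<le> c (\<pi> j)" if "1 \<le> i" "i \<le> j" "j \<le> l" for i j
    using assms(5) that by (simp add: c_def)
  have pos: "1 \<le> c (\<pi> i)" if "1 \<le> i" "i \<le> l" for i
  proof -
    have "\<pi> i \<in> T" using image that by auto
    then show ?thesis
      using assms(3) by (simp add: T_def c_def realized_types_iff is_model_def Suc_le_eq)
  qed
  show ?thesis
  proof (cases "\<tau> = {}")
    case True
    then have "l = 1" using card \<open>l \<ge> 1\<close> by simp
    \<comment> \<open>Here \<open>c_const \<tau>\<close> is 0, and
      \<open>3 * c (\<pi> l) \<ge> 3\<close> covers the size 2.\<close>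
    then have "enat 2 \<le> enat (3 * type_count \<tau> M (\<pi> l) + c_const \<tau>)"
      using pos[of l] by (simp add: c_def)
    with description_complexity_empty_vocabulary[of n M] True \<open>l = 1\<close> assms(2,3) show ?thesis
      by (auto intro: order_trans)
  next
    case False
    then obtain P Ps where \<tau>: "\<tau> = set (P # Ps)" and distinct: "distinct (P # Ps)"
      using finite_distinct_list[OF \<open>finite \<tau>\<close>] by (metis list.exhaust set_empty)
    define p where "p = length Ps"
    define N :: nat where "N = 2 ^ card \<tau>"
    have cp: "card \<tau> = p + 1"
      unfolding \<tau> distinct_card[OF distinct] by (simp add: p_def)
    have const: "c_const \<tau> = 15 * (p + 1) * N" by (simp add: c_const_def N_def cp)
    have "N \<ge> 2" by (simp add: N_def cp)
    have "l \<le> N" using card by (simp add: N_def)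
    \<comment> \<open>The upper end is excluded: \<open>k = Suc l\<close> lists all types,
      \<open>k = l\<close> drops the largest.\<close>
    have sorted: "sorted (map c (map \<pi> [1..<k]))" if "k \<le> Suc l" for k
      using that by (auto simp: sorted_iff_nth_mono intro!: mono)
    have max: "description_complexity \<tau> n M \<le> enat (3 * c (\<pi> l) + c_const \<tau>)"
    proof -
      define L where "L = map \<pi> [1..<Suc l]"
      have L: "set L = T"
        by (simp add: L_def image[symmetric] atLeastLessThanSuc_atLeastAtMost del: upt_Suc)
      have "c \<rho> \<le> c (\<pi> l)" if "\<rho> \<in> T" for \<rho>
        using that mono unfolding image[symmetric] by auto
      then have "description_complexity \<tau> n M
          \<le> enat (3 * c (\<pi> l) + length L * (6 * length Ps + 7) + 2)"
        using L sorted[of "Suc l"] pos[of l] \<open>l \<ge> 1\<close> unfolding c_def T_def L_def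
        by (intro description_complexity_le_max[OF \<tau> assms(2,3)]) (simp_all del: upt_Suc)
      \<comment> \<open>Since \<open>N \<ge> 2\<close>, a further \<open>N\<close> absorbs the 2;
        then \<open>N * (6 * p + 8) \<le> 15 * (p + 1) * N\<close>.\<close>
      also have "length L * (6 * length Ps + 7) + 2 \<le> N * (6 * p + 7) + N"
        using \<open>l \<le> N\<close> \<open>N \<ge> 2\<close> by (intro add_mono mult_mono) (auto simp: L_def p_def)
      then have "enat (3 * c (\<pi> l) + length L * (6 * length Ps + 7) + 2)
          \<le> enat (3 * c (\<pi> l) + c_const \<tau>)"
        by (simp add: const algebra_simps)
      finally show ?thesis .
    qed
    have second: "description_complexity \<tau> n M \<le> enat (6 * c (\<pi> (l - 1)) + c_const \<tau>)"
      if "l \<noteq> 1"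
    proof -
      define L where "L = map \<pi> [1..<l]"
      have L: "set L = T - {\<pi> l}"
      proof -
        have "{1..<l} = {1..l} - {l}" by auto
        then show ?thesis
          using inj_on_image_set_diff[OF inj, of "{1..l}" "{l}"] \<open>l \<ge> 1\<close>
          by (simp add: L_def image[symmetric])
      qed
      have "\<pi> l \<in> T" using image \<open>l \<ge> 1\<close> by auto
      moreover have "c \<rho> \<le> c (\<pi> (l - 1))" if "\<rho> \<in> set L" for \<rho>
        using that mono by (auto simp: L_def)
      ultimately have "description_complexity \<tau> n M \<le> enat (6 * c (\<pi> (l - 1))
          + length L * (10 * length Ps + 11) + (2 * length Ps + 6))"
        using L sorted[of l] pos[of "l - 1"] \<open>l \<ge> 1\<close> that
        unfolding c_def T_def L_def
        by (intro description_complexity_le_second[OF \<tau> assms(2,3)]) simp_all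
      \<comment> \<open>Only \<open>l - 1\<close> types remain; the share \<open>10 * p + 11\<close>
        of the dropped one covers the extra \<open>2 * p + 6\<close>, and
        \<open>10 * p + 11 \<le> 15 * (p + 1)\<close>.\<close>
      also have "length L * (10 * length Ps + 11) + (10 * p + 11) = l * (10 * p + 11)"
        using \<open>l \<ge> 1\<close> by (cases l) (simp_all add: L_def p_def del: mult_Suc_right)
      then have "length L * (10 * length Ps + 11) + (10 * p + 11) \<le> N * (10 * p + 11)"
        using \<open>l \<le> N\<close> by simp
      then have "enat (6 * c (\<pi> (l - 1)) + length L * (10 * length Ps + 11) + (2 * length Ps + 6))
          \<le> enat (6 * c (\<pi> (l - 1)) + c_const \<tau>)"
        by (simp add: const p_def algebra_simps)
      finally show ?thesis .
    qed
    show ?thesis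
    proof (cases "l = 1")
      case True
      then show ?thesis using max by (simp add: c_def)
    next
      case False
      then show ?thesis using max second[OF False] unfolding c_def min_def by simp
    qed
  qed
qed

end
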